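(* For $|q|<1$, $$\sum_{m,k,n\geq0}\frac{q^{2T(k)+2T(m+k)+n^2}}{(q)_m(q)_{2k+1}}\begin{bmatrix} k\\ n\end{bmatrix}_q=\frac{(q^{21},q^6,q^{15};q^{21})_\infty}{(q)_\infty}.$$
   Context: For $m$ a nonnegative integer, $(a)_m=(a;q)_m=\prod_{j=0}^{m-1}(1-aq^j)$ (with $(a)_0=1$), $(a;q)_\infty=\prod_{j\ge0}(1-aq^j)$, $(q)_\infty=(q;q)_\infty$, and $(a_1,\ldots,a_r;q)_\infty=(a_1;q)_\infty\cdots(a_r;q)_\infty$. In particular $(q)_m=\prod_{j=1}^m(1-q^j)$. The $q$-binomial coefficient is $\begin{bmatrix} m+n\\ m\end{bmatrix}_q=\frac{(q)_{m+n}}{(q)_m(q)_n}$ if $m,n$ are nonnegative integers, and it is $0$ otherwise (so $\begin{bmatrix} A\\ B\end{bmatrix}_q=0$ unless $0\le B\le A$). $T(j)=\frac{j(j+1)}{2}$. *)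

theory Defs
  imports "HOL-Analysis.Analysis"
begin

definition qpoch :: "complex \<Rightarrow> complex \<Rightarrow> nat \<Rightarrow> complex" where
  "qpoch a q m = (\<Prod>j<m. 1 - a * q ^ j)"

definition qpoch_inf :: "complex \<Rightarrow> complex \<Rightarrow> complex" where
  "qpoch_inf a q = (\<Prod>j. 1 - a * q ^ j)"

text \<open>
  The Gaussian coefficient with top entry \<open>A\<close> and bottom entry \<open>B\<close>; the guard is needed because
  subtraction on \<^typ>\<open>nat\<close> truncates.
\<close>
definition qbinom :: "complex \<Rightarrow> nat \<Rightarrow> nat \<Rightarrow> complex" where
  "qbinom q A B =
     (if B \<le> A then qpoch q q A / (qpoch q q B * qpoch q q (A - B)) else 0)"

definition T :: "nat \<Rightarrow> nat" where
  "T j = j * (j + 1) div 2"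

end

theory Submission
  imports Defs "HOL-Library.Nat_Bijection"
begin

text \<open>
  Bressoud's finite Rogers--Ramanujan identity writes \<open>\<Sum>n. q^(n\<^sup>2) [k, n]\<close> as the bilateral sum
  \<open>\<Sum>j. (-1)^j q^(j(5j+1)/2) [2k+1, k-2j]\<close>; in other words, it is a Bailey pair relative to \<open>a = q\<close>
  supported on even indices. After this substitution the sum over \<open>m\<close> and \<open>k\<close> is two steps of the
  Bailey chain, and each \<open>j\<close> contributes \<open>q^(2r(r+1)) / (q)\<^sub>\<infinity>\<close> with \<open>r = 2j\<close>. The exponents add up to
  \<open>(21j\<^sup>2 + 9j)/2\<close>, and the Jacobi triple product finishes the proof.
\<close>

section \<open>Gaussian coefficients\<close>

text \<open>Bressoud's form fits because the factor (q)_{2k+1} cancels the numerator of [2k+1, k-r]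
  and leaves 1/((q)_{k-r} (q)_{k+r+1}), the Bailey kernel for a = q. Each r can therefore be treated
  separately. The analytic obstacle is the order of summation: the substitution introduces a signed
  bilateral index j, which has to be exchanged with (m, k). A bound on Gaussian coefficients that is
  uniform in both entries, together with the geometric decay of the remaining factors, gives
  absolute convergence. The algebraic obstacle is that q = 0 is allowed, so negative powers must not
  occur. Integer exponents pass through \<open>nat\<close>, and every reflection of j is checked to
  keep them nonnegative on the support of the Gaussian coefficients.\<close>

lemma qpoch_0 [simp]: "qpoch a q 0 = 1"
  by (simp add: qpoch_def)

lemma qpoch_Suc: "qpoch a q (Suc n) = qpoch a q n * (1 - a * q ^ n)"
  by (simp add: qpoch_def)

lemma one_minus_power_nonzero:
  fixes q :: complex
  assumes "norm q < 1"
  shows "1 - q * q ^ n \<noteq> 0"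
proof
  assume "1 - q * q ^ n = 0"
  hence "norm (q ^ Suc n) = 1" by simp
  moreover have "norm (q ^ Suc n) < 1"
    unfolding norm_power using assms by (intro power_less_one_iff[THEN iffD2]) auto
  ultimately show False by simp
qed

lemma qpoch_self_nonzero: "norm q < 1 \<Longrightarrow> qpoch q q n \<noteq> 0"
  using one_minus_power_nonzero[of q] by (simp add: qpoch_def)

section \<open>Infinite q-products: convergence, nonvanishing, bounds\<close>

lemma convergent_prod_qpoch:
  fixes a q :: complex
  assumes "norm q < 1"
  shows "convergent_prod (\<lambda>j. 1 - a * q ^ j)"
proof (intro abs_convergent_prod_imp_convergent_prod summable_imp_abs_convergent_prod)
  have "summable (\<lambda>j. norm a * norm q ^ j)"
    using assms by (intro summable_mult summable_geometric) auto
  thus "summable (\<lambda>j. norm (1 - a * q ^ j - 1))"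
    by (simp add: norm_mult norm_power)
qed

lemma qpoch_tendsto:
  assumes "norm q < 1"
  shows "qpoch a q \<longlonglongrightarrow> qpoch_inf a q"
proof -
  have "(\<lambda>n. \<Prod>j\<le>n. 1 - a * q ^ j) \<longlonglongrightarrow> qpoch_inf a q"
    unfolding qpoch_inf_def
    by (rule convergent_prod_LIMSEQ[OF convergent_prod_qpoch[OF assms]])
  hence "(\<lambda>n. qpoch a q (Suc n)) \<longlonglongrightarrow> qpoch_inf a q"
    by (simp add: qpoch_def lessThan_Suc_atMost)
  thus ?thesis by (rule LIMSEQ_imp_Suc)
qed

lemma qpoch_inf_self_nonzero:
  assumes "norm q < 1"
  shows "qpoch_inf q q \<noteq> 0"
  unfolding qpoch_inf_def
  using prodinf_nonzero[OF convergent_prod_qpoch[OF assms, of q]] one_minus_power_nonzero[OF assms]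
  by simp

lemma qpoch_inverse_tendsto:
  assumes "norm q < 1"
  shows "(\<lambda>n. 1 / qpoch q q n) \<longlonglongrightarrow> 1 / qpoch_inf q q"
  by (intro tendsto_intros qpoch_tendsto assms qpoch_inf_self_nonzero)

lemma qpoch_inverse_bounded:
  assumes "norm q < 1"
  obtains C where "\<And>n. norm (1 / qpoch q q n) \<le> C" "C \<ge> 1"
proof -
  have "Bseq (\<lambda>n. 1 / qpoch q q n)"
    by (rule convergent_imp_Bseq, rule convergentI, rule qpoch_inverse_tendsto[OF assms])
  then obtain K where K: "\<And>n. norm (1 / qpoch q q n) \<le> K"
    by (auto simp: Bseq_def)
  show ?thesis
    by (rule that[of K]) (use K K[of 0] in auto)
qed

text \<open>An integer lower index lets every sum below run over all of \<open>\<int>\<close>.\<close>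
definition qbinom_int :: "complex \<Rightarrow> nat \<Rightarrow> int \<Rightarrow> complex" where
  "qbinom_int q n k = (if k < 0 then 0 else qbinom q n (nat k))"

lemma qbinom_0 [simp]: "norm q < 1 \<Longrightarrow> qbinom q n 0 = 1"
  by (simp add: qbinom_def qpoch_self_nonzero)

lemma qbinom_eq_0: "n < k \<Longrightarrow> qbinom q n k = 0"
  by (simp add: qbinom_def)

lemma qbinom_self [simp]: "norm q < 1 \<Longrightarrow> qbinom q n n = 1"
  by (simp add: qbinom_def qpoch_self_nonzero)

text \<open>The products (q)_n and their reciprocals converge, hence are bounded, so one constant
  serves all entries. This uniformity supplies the majorants for the limits and interchanges of sums
  below.\<close>

lemma qbinom_bounded:
  assumes "norm q < 1"
  obtains C where "\<And>n k. norm (qbinom q n k) \<le> C" "C \<ge> 0"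
proof -
  obtain C where C: "\<And>n. norm (1 / qpoch q q n) \<le> C" "C \<ge> 1"
    using qpoch_inverse_bounded[OF assms] by blast
  have "Bseq (qpoch q q)"
    by (rule convergent_imp_Bseq, rule convergentI, rule qpoch_tendsto[OF assms])
  then obtain K where K: "K > 0" "\<And>n. norm (qpoch q q n) \<le> K"
    by (auto simp: Bseq_def)
  have "norm (qbinom q n k) \<le> K * (C * C)" for n k
  proof (cases "k \<le> n")
    case True
    hence "norm (qbinom q n k)
        = norm (qpoch q q n) * (norm (1 / qpoch q q k) * norm (1 / qpoch q q (n - k)))"
      by (simp add: qbinom_def norm_mult norm_divide)
    also have "\<dots> \<le> K * (C * C)"
      using C K by (intro mult_mono) auto
    finally show ?thesis .
  next
    case False
    thus ?thesis using K C by (simp add: qbinom_def)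
  qed
  moreover have "K * (C * C) \<ge> 0" using K C by simp
  ultimately show ?thesis using that by blast
qed

lemma qbinom_symmetric: "k \<le> n \<Longrightarrow> qbinom q n (n - k) = qbinom q n k"
  by (simp add: qbinom_def)

lemma qbinom_pascal:
  assumes "norm q < 1"
  shows "qbinom q (Suc n) (Suc k) = qbinom q n k + q ^ Suc k * qbinom q n (Suc k)"
proof (cases "Suc k \<le> n")
  case True
  then obtain d where d: "n = Suc k + d" using le_Suc_ex by blast
  have nz: "qpoch q q m \<noteq> 0" "1 - q * q ^ m \<noteq> 0" for m
    using qpoch_self_nonzero[OF assms] one_minus_power_nonzero[OF assms] by auto
  have 1: "qbinom q (Suc n) (Suc k)
      = qpoch q q n * (1 - q * q ^ n) / (qpoch q q k * (1 - q * q ^ k) * (qpoch q q d * (1 - q * q ^ d)))"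
    by (simp add: qbinom_def d qpoch_Suc)
  have 2: "qbinom q n k = qpoch q q n / (qpoch q q k * (qpoch q q d * (1 - q * q ^ d)))"
    by (simp add: qbinom_def d qpoch_Suc)
  have 3: "qbinom q n (Suc k) = qpoch q q n / (qpoch q q k * (1 - q * q ^ k) * qpoch q q d)"
    by (simp add: qbinom_def d qpoch_Suc)
  have 4: "q ^ n = q ^ k * q * q ^ d" by (simp add: d power_add)
  show ?thesis
    unfolding 1 2 3 4 using nz by (simp add: divide_simps) (simp add: algebra_simps)
next
  case False
  show ?thesis
  proof (cases "k = n")
    case True
    thus ?thesis using assms by (simp add: qbinom_eq_0)
  next
    case False
    with \<open>\<not> Suc k \<le> n\<close> show ?thesis by (simp add: qbinom_eq_0)
  qed
qed

lemma qbinom_pascal':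
  assumes "norm q < 1" "k \<le> n"
  shows "qbinom q (Suc n) (Suc k) = qbinom q n (Suc k) + q ^ (n - k) * qbinom q n k"
proof (cases "k = n")
  case True
  thus ?thesis using assms by (simp add: qbinom_eq_0)
next
  case False
  then obtain d where d: "n = Suc k + d" using assms(2) le_Suc_ex[of "Suc k" n] by auto
  have "qbinom q (Suc n) (Suc k) = qbinom q (Suc n) (Suc d)"
    using qbinom_symmetric[of "Suc d" "Suc n" q] by (simp add: d)
  also have "\<dots> = qbinom q n d + q ^ Suc d * qbinom q n (Suc d)"
    by (rule qbinom_pascal[OF assms(1)])
  also have "qbinom q n d = qbinom q n (Suc k)"
    using qbinom_symmetric[of d n q] by (simp add: d)
  also have "qbinom q n (Suc d) = qbinom q n k"
    using qbinom_symmetric[of "Suc d" n q] by (simp add: d)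
  finally show ?thesis by (simp add: d)
qed

lemma qbinom_int_eq_0: "k < 0 \<or> k > int n \<Longrightarrow> qbinom_int q n k = 0"
  by (auto simp: qbinom_int_def qbinom_def)

lemma qbinom_int_of_nat [simp]: "qbinom_int q n (int k) = qbinom q n k"
  by (simp add: qbinom_int_def)

lemma qbinom_int_symmetric: "qbinom_int q n (int n - k) = qbinom_int q n k"
proof (cases "k < 0 \<or> k > int n")
  case True
  thus ?thesis using qbinom_int_eq_0[of k n] qbinom_int_eq_0[of "int n - k" n] by auto
next
  case False
  then obtain i where i: "k = int i" "i \<le> n"
    by (metis linorder_not_less nonneg_int_cases of_nat_le_iff)
  thus ?thesis using qbinom_symmetric[of i n q]
    by (metis of_nat_diff qbinom_int_of_nat)
qed

text \<open>Truncation by \<open>nat\<close> is harmless: for negative \<open>k\<close> the Gaussian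
  coefficient next to the power is zero.\<close>

lemma qbinom_int_pascal:
  assumes "norm q < 1"
  shows "qbinom_int q (Suc n) k = qbinom_int q n (k - 1) + q ^ nat k * qbinom_int q n k"
proof (cases "k \<le> 0")
  case True
  thus ?thesis using assms by (cases "k = 0") (auto simp: qbinom_int_def)
next
  case False
  then obtain i where i: "k = int (Suc i)"
    by (metis gr0_implies_Suc not_le zero_less_imp_eq_int)
  have "k - 1 = int i" using i by simp
  thus ?thesis unfolding i using qbinom_pascal[OF assms, of n i] 
    by (metis nat_int qbinom_int_of_nat)
qed

lemma qbinom_int_pascal':
  assumes "norm q < 1"
  shows "qbinom_int q (Suc n) k = qbinom_int q n k + q ^ nat (int (Suc n) - k) * qbinom_int q n (k - 1)"
proof -
  have "qbinom_int q (Suc n) k = qbinom_int q (Suc n) (int (Suc n) - k)"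
    by (rule qbinom_int_symmetric[symmetric])
  also have "\<dots> = qbinom_int q n (int (Suc n) - k - 1)
      + q ^ nat (int (Suc n) - k) * qbinom_int q n (int (Suc n) - k)"
    by (rule qbinom_int_pascal[OF assms])
  also have "qbinom_int q n (int (Suc n) - k - 1) = qbinom_int q n k"
    using qbinom_int_symmetric[of q n k] by (simp add: algebra_simps)
  also have "qbinom_int q n (int (Suc n) - k) = qbinom_int q n (k - 1)"
    using qbinom_int_symmetric[of q n "k - 1"] by (simp add: algebra_simps)
  finally show ?thesis .
qed

lemma qbinom_int_bounded:
  assumes "norm q < 1"
  obtains C where "\<And>n k. norm (qbinom_int q n k) \<le> C" "C \<ge> 0"
proof -
  obtain C where "\<And>n k. norm (qbinom q n k) \<le> C" "C \<ge> 0"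
    using qbinom_bounded[OF assms] by blast
  thus ?thesis by (intro that[of C]) (auto simp: qbinom_int_def)
qed

section \<open>Limits of sums\<close>

text \<open>Dominated convergence in a form that also identifies the limit: finite identities
  provide the sums \<open>s n\<close>, and their limit \<open>L\<close> must be the sum of the
  termwise limits. The bijection \<open>h\<close> enumerates the index type, so that the theorem on
  ordinary series applies.\<close>

lemma tannery_has_sum:
  fixes f :: "nat \<Rightarrow> 'a \<Rightarrow> complex" and h :: "nat \<Rightarrow> 'a"
  assumes h: "bij h"
    and lim: "\<And>j. (\<lambda>n. f n j) \<longlonglongrightarrow> g j"
    and bound: "\<And>n j. norm (f n j) \<le> M j"
    and M: "M summable_on UNIV"
    and sums: "\<And>n. (f n has_sum s n) UNIV"
    and s: "s \<longlonglongrightarrow> L"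
  shows "(g has_sum L) UNIV"
proof -
  have "(M \<circ> h) summable_on UNIV"
    using M h summable_on_reindex_bij_betw[of h UNIV UNIV M] by (simp add: o_def)
  hence "summable (M \<circ> h)" by (rule summable_on_imp_summable)
  hence T: "summable (\<lambda>k. norm (g (h k)))"
     "(\<lambda>n. suminf (\<lambda>k. f n (h k))) \<longlonglongrightarrow> suminf (\<lambda>k. g (h k))"
    using tannerys_theorem[of "\<lambda>k n. f n (h k)" "\<lambda>k. g (h k)" sequentially "M \<circ> h",
        OF lim always_eventually] bound
    by auto
  have "((\<lambda>k. f n (h k)) has_sum s n) UNIV" for n
    using sums[of n] h has_sum_reindex_bij_betw[of h UNIV UNIV "f n" "s n"] by simp
  hence "suminf (\<lambda>k. f n (h k)) = s n" for n
    using has_sum_imp_sums sums_unique by metis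
  with T(2) s have "L = suminf (\<lambda>k. g (h k))"
    by (simp add: LIMSEQ_unique)
  hence "(\<lambda>k. g (h k)) sums L"
    using summable_norm_cancel[OF T(1)] summable_sums by metis
  hence "((\<lambda>k. g (h k)) has_sum L) UNIV"
    by (rule norm_summable_imp_has_sum[OF T(1)])
  thus ?thesis
    using h has_sum_reindex_bij_betw[of h UNIV UNIV g L] by simp
qed

text \<open>This is the case M \<rightarrow> \<infinity> of the q-Chu-Vandermonde sum of q^(s(s+c))
  [N, s] [M, s+c] over s, with value [N+M, N+c]. The parameter \<open>c\<close> has to vary in the
  induction, because Pascal's rule leads from N + 1 to N with both c and c + 1.\<close>

lemma qvandermonde_limit:
  assumes "norm q < 1"
  shows "(\<Sum>s\<le>N. q ^ (s * (s + c)) * qbinom q N s / qpoch q q (s + c)) = 1 / qpoch q q (N + c)"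
proof (induction N arbitrary: c)
  case 0
  show ?case using assms by simp
next
  case (Suc N)
  let ?F = "\<lambda>N c s. q ^ (s * (s + c)) * qbinom q N s / qpoch q q (s + c)"
  have step: "?F (Suc N) c (Suc s) = ?F N c (Suc s) + q ^ (N + c + 1) * ?F N (Suc c) s" if "s \<le> N" for s
  proof -
    have "Suc s * (Suc s + c) + (N - s) = (N + c + 1) + s * (s + Suc c)"
      using that by (simp add: algebra_simps)
    hence "q ^ (Suc s * (Suc s + c)) * q ^ (N - s) = q ^ (N + c + 1) * q ^ (s * (s + Suc c))"
      by (metis power_add)
    hence "q ^ (Suc s * (Suc s + c)) * qbinom q (Suc N) (Suc s)
        = q ^ (Suc s * (Suc s + c)) * qbinom q N (Suc s)
          + q ^ (N + c + 1) * (q ^ (s * (s + Suc c)) * qbinom q N s)"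
      unfolding qbinom_pascal'[OF assms that] by (simp add: ring_distribs del: mult_Suc power_Suc flip: mult.assoc)
    thus ?thesis by (simp add: add_divide_distrib del: mult_Suc power_Suc)
  qed
  have "(\<Sum>s\<le>Suc N. ?F (Suc N) c s) = ?F (Suc N) c 0 + (\<Sum>s\<le>N. ?F (Suc N) c (Suc s))"
    by (rule sum.atMost_Suc_shift)
  also have "(\<Sum>s\<le>N. ?F (Suc N) c (Suc s))
      = (\<Sum>s\<le>N. ?F N c (Suc s)) + q ^ (N + c + 1) * (\<Sum>s\<le>N. ?F N (Suc c) s)"
    unfolding sum_distrib_left sum.distrib[symmetric] by (intro sum.cong refl step) simp
  also have "?F (Suc N) c 0 + \<dots> = (\<Sum>s\<le>Suc N. ?F N c s) + q ^ (N + c + 1) * (\<Sum>s\<le>N. ?F N (Suc c) s)"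
    unfolding sum.atMost_Suc_shift[of "?F N c" N] using assms by simp
  also have "(\<Sum>s\<le>Suc N. ?F N c s) = (\<Sum>s\<le>N. ?F N c s)"
    by (simp add: qbinom_eq_0)
  also have "\<dots> + q ^ (N + c + 1) * (\<Sum>s\<le>N. ?F N (Suc c) s)
      = 1 / qpoch q q (N + c) + q ^ (N + c + 1) / qpoch q q (Suc (N + c))"
    unfolding Suc.IH by simp
  also have "\<dots> = 1 / qpoch q q (Suc N + c)"
    using qpoch_self_nonzero[OF assms, of "N + c"] one_minus_power_nonzero[OF assms, of "N + c"]
    by (simp add: qpoch_Suc divide_simps)
  finally show ?case .
qed

lemma summable_on_norm_power:
  fixes q :: complex
  assumes "norm q < 1"
  shows "(\<lambda>n::nat. norm q ^ n) summable_on UNIV"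
  by (rule norm_summable_imp_summable_on) (use assms in simp)

text \<open>Let N tend to infinity in \<open>qvandermonde_limit\<close>, where [N, s] tends to
  1/(q)_s. Combinatorially, each partition is cut along its largest s by s + c rectangle.\<close>

lemma durfee_sum:
  assumes "norm q < 1"
  shows "((\<lambda>s. q ^ (s * (s + c)) / (qpoch q q s * qpoch q q (s + c))) has_sum 1 / qpoch_inf q q) UNIV"
proof -
  obtain C where C: "\<And>n. norm (1 / qpoch q q n) \<le> C" "C \<ge> 1"
    using qpoch_inverse_bounded[OF assms] by blast
  obtain D where D: "\<And>n k. norm (qbinom q n k) \<le> D" "D \<ge> 0"
    using qbinom_bounded[OF assms] by blast
  show ?thesis
  proof (rule tannery_has_sum[where h = id and M = "\<lambda>s. norm q ^ s * D * C"
        and f = "\<lambda>N s. q ^ (s * (s + c)) * qbinom q N s / qpoch q q (s + c)"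
        and s = "\<lambda>N. 1 / qpoch q q (N + c)"])
    fix s
    have "(\<lambda>N. qpoch q q N / (qpoch q q s * qpoch q q (N - s)))
        \<longlonglongrightarrow> qpoch_inf q q / (qpoch q q s * qpoch_inf q q)"
      using assms by (intro tendsto_intros qpoch_tendsto LIMSEQ_offset[of "\<lambda>N. qpoch q q (N - s)" s])
        (simp_all add: qpoch_self_nonzero qpoch_inf_self_nonzero qpoch_tendsto)
    hence "(\<lambda>N. qpoch q q N / (qpoch q q s * qpoch q q (N - s))) \<longlonglongrightarrow> 1 / qpoch q q s"
      using qpoch_inf_self_nonzero[OF assms] by simp
    moreover have "eventually (\<lambda>N. qpoch q q N / (qpoch q q s * qpoch q q (N - s)) = qbinom q N s) sequentially"
      using eventually_ge_at_top[of s] by eventually_elim (simp add: qbinom_def)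
    ultimately have "(\<lambda>N. qbinom q N s) \<longlonglongrightarrow> 1 / qpoch q q s"
      by (rule Lim_transform_eventually)
    hence "(\<lambda>N. q ^ (s * (s + c)) * qbinom q N s / qpoch q q (s + c))
        \<longlonglongrightarrow> q ^ (s * (s + c)) * (1 / qpoch q q s) / qpoch q q (s + c)"
      by (intro tendsto_intros qpoch_self_nonzero assms)
    thus "(\<lambda>N. q ^ (s * (s + c)) * qbinom q N s / qpoch q q (s + c))
        \<longlonglongrightarrow> q ^ (s * (s + c)) / (qpoch q q s * qpoch q q (s + c))"
      by simp
  next
    fix N s
    have "norm q ^ (s * (s + c)) \<le> norm q ^ s"
      using assms by (intro power_decreasing) (cases s, auto)
    hence "norm q ^ (s * (s + c)) * norm (qbinom q N s) * norm (1 / qpoch q q (s + c)) \<le> norm q ^ s * D * C"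
      using C D by (intro mult_mono) auto
    thus "norm (q ^ (s * (s + c)) * qbinom q N s / qpoch q q (s + c)) \<le> norm q ^ s * D * C"
      by (simp add: norm_mult norm_divide norm_power)
  next
    show "(\<lambda>s. norm q ^ s * D * C) summable_on UNIV"
      by (intro summable_on_cmult_left summable_on_norm_power assms)
  next
    fix N
    show "((\<lambda>s. q ^ (s * (s + c)) * qbinom q N s / qpoch q q (s + c)) has_sum 1 / qpoch q q (N + c)) UNIV"
      by (rule has_sum_finite_neutralI[of "{..N}"])
         (auto simp: qvandermonde_limit[OF assms] qbinom_eq_0)
  next
    show "(\<lambda>N. 1 / qpoch q q (N + c)) \<longlonglongrightarrow> 1 / qpoch_inf q q"
      by (rule LIMSEQ_ignore_initial_segment[OF qpoch_inverse_tendsto[OF assms]])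
  qed auto
qed

section \<open>Bressoud's identity\<close>

definition alt :: "int \<Rightarrow> complex" where
  "alt j = (if even j then 1 else - 1)"

lemma alt_uminus [simp]: "alt (- j) = alt j"
  by (simp add: alt_def)

lemma alt_reflect [simp]: "alt (- 1 - j) = - alt j"
  by (simp add: alt_def)

text \<open>The coefficients of Bressoud's identity and of the companion identity for
  \<open>\<Sum>n. q^(n\<^sup>2+n) [k, n]\<close>; the two are proved by a simultaneous induction on \<open>k\<close>.\<close>
definition bressoud_a :: "complex \<Rightarrow> int \<Rightarrow> complex" where
  "bressoud_a q j = alt j * q ^ nat (j * (5 * j + 1) div 2)"

definition bressoud_b :: "complex \<Rightarrow> int \<Rightarrow> complex" where
  "bressoud_b q j = alt j * q ^ nat (j * (5 * j + 3) div 2)"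

lemma two_times_half_5_1: "2 * (j * (5 * j + 1) div 2) = j * (5 * j + 1)" for j :: int
  by (rule dvd_mult_div_cancel) (auto simp: even_mult_iff)

lemma two_times_half_5_3: "2 * (j * (5 * j + 3) div 2) = j * (5 * j + 3)" for j :: int
  by (rule dvd_mult_div_cancel) (auto simp: even_mult_iff)

lemma int_mult_linear_nonneg:
  fixes j :: int
  assumes "a \<ge> 0" "a \<le> c"
  shows "j * (c * j + a) \<ge> 0"
proof (cases "j \<ge> 0")
  case True
  thus ?thesis using assms by simp
next
  case False
  have "c * j \<le> c * (- 1)" using False assms by (intro mult_left_mono) auto
  thus ?thesis using False assms by (intro mult_nonpos_nonpos) auto
qed

lemma half_5_1_nonneg: "j * (5 * j + 1) div 2 \<ge> 0" for j :: int
  using int_mult_linear_nonneg[of 1 5 j] by simp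

lemma half_5_3_nonneg: "j * (5 * j + 3) div 2 \<ge> 0" for j :: int
  using int_mult_linear_nonneg[of 3 5 j] by simp

lemma nat_power_combine: "a \<ge> 0 \<Longrightarrow> b \<ge> 0 \<Longrightarrow> q ^ nat a * q ^ nat b = q ^ nat (a + b)"
  for q :: complex
  by (simp add: nat_add_distrib power_add)

text \<open>Only finitely many terms are nonzero; summing over all integers makes the reflections of
  j plain reindexings, without bounds to keep track of.\<close>

definition qbinom_series :: "complex \<Rightarrow> (int \<Rightarrow> complex) \<Rightarrow> nat \<Rightarrow> int \<Rightarrow> complex" where
  "qbinom_series q c n m = (\<Sum>\<^sub>\<infinity>j. c j * qbinom_int q n (m - 2 * j))"

lemma summable_on_qbinom_int: "(\<lambda>j. c j * qbinom_int q n (m - 2 * j)) summable_on UNIV"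
proof -
  have "finite {j. 0 \<le> m - 2 * j \<and> m - 2 * j \<le> int n}"
    by (rule finite_subset[of _ "{- \<bar>m\<bar> - int n..\<bar>m\<bar>}"]) auto
  moreover have "c j * qbinom_int q n (m - 2 * j) = 0" 
    if "j \<notin> {j. 0 \<le> m - 2 * j \<and> m - 2 * j \<le> int n}" for j
    using that qbinom_int_eq_0[of "m - 2 * j" n q] by auto
  ultimately show ?thesis
    using summable_on_cong_neutral[of "{j. 0 \<le> m - 2 * j \<and> m - 2 * j \<le> int n}" UNIV
        "\<lambda>j. c j * qbinom_int q n (m - 2 * j)" "\<lambda>j. c j * qbinom_int q n (m - 2 * j)"]
    by auto
qed

lemma infsum_int_uminus: "(\<Sum>\<^sub>\<infinity>j. f (- j)) = (\<Sum>\<^sub>\<infinity>j::int. f j :: complex)"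
  by (rule infsum_reindex_bij_witness[of _ uminus uminus]) auto

lemma infsum_int_reflect: "(\<Sum>\<^sub>\<infinity>j. f (- 1 - j)) = (\<Sum>\<^sub>\<infinity>j::int. f j :: complex)"
  by (rule infsum_reindex_bij_witness[of _ "\<lambda>j. - 1 - j" "\<lambda>j. - 1 - j"]) auto

lemma qbinom_series_pascal:
  assumes "norm q < 1"
  shows "qbinom_series q c (Suc n) m = qbinom_series q c n (m - 1)
           + qbinom_series q (\<lambda>j. c j * q ^ nat (m - 2 * j)) n m"
proof -
  have "qbinom_series q c (Suc n) m = (\<Sum>\<^sub>\<infinity>j. c j * qbinom_int q n (m - 1 - 2 * j)
      + c j * q ^ nat (m - 2 * j) * qbinom_int q n (m - 2 * j))"
    unfolding qbinom_series_def qbinom_int_pascal[OF assms]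
    by (intro infsum_cong) (simp add: algebra_simps)
  thus ?thesis
    unfolding qbinom_series_def by (simp add: infsum_add summable_on_qbinom_int)
qed

lemma qbinom_series_pascal':
  assumes "norm q < 1"
  shows "qbinom_series q c (Suc n) m = qbinom_series q c n m
           + qbinom_series q (\<lambda>j. c j * q ^ nat (int (Suc n) - m + 2 * j)) n (m - 1)"
proof -
  have "qbinom_series q c (Suc n) m = (\<Sum>\<^sub>\<infinity>j. c j * qbinom_int q n (m - 2 * j)
      + c j * q ^ nat (int (Suc n) - m + 2 * j) * qbinom_int q n (m - 1 - 2 * j))"
    unfolding qbinom_series_def qbinom_int_pascal'[OF assms]
    by (intro infsum_cong) (simp add: algebra_simps)
  thus ?thesis
    unfolding qbinom_series_def by (simp add: infsum_add summable_on_qbinom_int)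
qed

text \<open>Restricting to the support of the Gaussian coefficient is what makes the exponents under
  \<open>nat\<close> nonnegative, as the reflection rules for the coefficients demand.\<close>

lemma qbinom_series_cong:
  assumes "\<And>j. 0 \<le> m - 2 * j \<Longrightarrow> m - 2 * j \<le> int n \<Longrightarrow> c j = d j"
  shows "qbinom_series q c n m = qbinom_series q d n m"
  unfolding qbinom_series_def
proof (rule infsum_cong)
  fix j
  show "c j * qbinom_int q n (m - 2 * j) = d j * qbinom_int q n (m - 2 * j)"
    using assms[of j] qbinom_int_eq_0[of "m - 2 * j" n q] by fastforce
qed

lemma qbinom_series_cmult: "qbinom_series q (\<lambda>j. x * c j) n m = x * qbinom_series q c n m"
  unfolding qbinom_series_def by (simp add: mult.assoc infsum_cmult_right')

lemma qbinom_series_uminus: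
  "qbinom_series q c n m = qbinom_series q (\<lambda>j. c (- j)) n (int n - m)"
proof -
  have "qbinom_series q c n m = (\<Sum>\<^sub>\<infinity>j. c (- j) * qbinom_int q n (m - 2 * (- j)))"
    unfolding qbinom_series_def by (rule infsum_int_uminus[symmetric])
  also have "(\<lambda>j. qbinom_int q n (m - 2 * (- j))) = (\<lambda>j. qbinom_int q n (int n - m - 2 * j))"
  proof
    fix j
    show "qbinom_int q n (m - 2 * (- j)) = qbinom_int q n (int n - m - 2 * j)"
      using qbinom_int_symmetric[of q n "m + 2 * j"] by (simp add: algebra_simps)
  qed
  hence "(\<Sum>\<^sub>\<infinity>j. c (- j) * qbinom_int q n (m - 2 * (- j)))
      = (\<Sum>\<^sub>\<infinity>j. c (- j) * qbinom_int q n (int n - m - 2 * j))"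
    by metis
  finally show ?thesis by (simp add: qbinom_series_def)
qed

text \<open>For n = 2m + 2 the lower index m is fixed, while \<open>alt\<close> changes sign under
  this reflection; a series with suitable weights then cancels itself.\<close>

lemma qbinom_series_reflect:
  "qbinom_series q c n m = qbinom_series q (\<lambda>j. c (- 1 - j)) n (int n - m - 2)"
proof -
  have "qbinom_series q c n m = (\<Sum>\<^sub>\<infinity>j. c (- 1 - j) * qbinom_int q n (m - 2 * (- 1 - j)))"
    unfolding qbinom_series_def by (rule infsum_int_reflect[symmetric])
  also have "(\<lambda>j. qbinom_int q n (m - 2 * (- 1 - j))) = (\<lambda>j. qbinom_int q n (int n - m - 2 - 2 * j))"
  proof
    fix j
    show "qbinom_int q n (m - 2 * (- 1 - j)) = qbinom_int q n (int n - m - 2 - 2 * j)"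
      using qbinom_int_symmetric[of q n "m + 2 + 2 * j"] by (simp add: algebra_simps)
  qed
  hence "(\<Sum>\<^sub>\<infinity>j. c (- 1 - j) * qbinom_int q n (m - 2 * (- 1 - j)))
      = (\<Sum>\<^sub>\<infinity>j. c (- 1 - j) * qbinom_int q n (int n - m - 2 - 2 * j))"
    by metis
  finally show ?thesis by (simp add: qbinom_series_def)
qed

text \<open>Because j(5j-1)/2 + 2j = j(5j+3)/2, a reflection together with a linear twist turns one
  coefficient family into the other.\<close>

lemma bressoud_a_shift:
  assumes "e \<ge> 0" "e = int k + 2 * j"
  shows "bressoud_a q (- j) * q ^ nat e = q ^ k * bressoud_b q j"
proof -
  have "- j * (5 * - j + 1) div 2 + e = int k + j * (5 * j + 3) div 2"
    using two_times_half_5_1[of "- j"] two_times_half_5_3[of j] assms by (simp add: algebra_simps)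
  hence "q ^ nat (- j * (5 * - j + 1) div 2) * q ^ nat e
      = q ^ nat (int k) * q ^ nat (j * (5 * j + 3) div 2)"
    using nat_power_combine[OF half_5_1_nonneg[of "- j"] assms(1), of q]
      nat_power_combine[OF _ half_5_3_nonneg[of j], of "int k" q] by simp
  thus ?thesis by (simp add: bressoud_a_def bressoud_b_def)
qed

lemma bressoud_b_shift:
  assumes "e \<ge> 0" "e = int k + 2 * j"
  shows "bressoud_b q (- j) * q ^ nat e = q ^ k * bressoud_a q j"
proof -
  have "- j * (5 * - j + 3) div 2 + e = int k + j * (5 * j + 1) div 2"
    using two_times_half_5_3[of "- j"] two_times_half_5_1[of j] assms by (simp add: algebra_simps)
  hence "q ^ nat (- j * (5 * - j + 3) div 2) * q ^ nat e
      = q ^ nat (int k) * q ^ nat (j * (5 * j + 1) div 2)"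
    using nat_power_combine[OF half_5_3_nonneg[of "- j"] assms(1), of q]
      nat_power_combine[OF _ half_5_1_nonneg[of j], of "int k" q] by simp
  thus ?thesis by (simp add: bressoud_a_def bressoud_b_def)
qed

text \<open>The exponents of \<open>bressoud_a\<close> at -1-j and at j differ by exactly 2(2j+1),
  and the signs are opposite.\<close>

lemma bressoud_a_reflect:
  assumes "e \<ge> 0" "e' \<ge> 0" "e' = e + 2 * (2 * j + 1)"
  shows "bressoud_a q (- 1 - j) * q ^ nat e = - (bressoud_a q j * q ^ nat e')"
proof -
  have "(- 1 - j) * (5 * (- 1 - j) + 1) div 2 + e = j * (5 * j + 1) div 2 + e'"
    using two_times_half_5_1[of "- 1 - j"] two_times_half_5_1[of j] assms by (simp add: algebra_simps)
  hence "q ^ nat ((- 1 - j) * (5 * (- 1 - j) + 1) div 2) * q ^ nat e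
      = q ^ nat (j * (5 * j + 1) div 2) * q ^ nat e'"
    using nat_power_combine[OF half_5_1_nonneg[of "- 1 - j"] assms(1), of q]
      nat_power_combine[OF half_5_1_nonneg[of j] assms(2), of q] by simp
  thus ?thesis by (simp add: bressoud_a_def)
qed

lemma bressoud_b_reflect:
  assumes "e \<ge> 0" "e = int k - 1 - 2 * j"
  shows "bressoud_b q (- 1 - j) * q ^ nat e = - (q ^ k * bressoud_b q j)"
proof -
  have "(- 1 - j) * (5 * (- 1 - j) + 3) div 2 + e = int k + j * (5 * j + 3) div 2"
    using two_times_half_5_3[of "- 1 - j"] two_times_half_5_3[of j] assms by (simp add: algebra_simps)
  hence "q ^ nat ((- 1 - j) * (5 * (- 1 - j) + 3) div 2) * q ^ nat e
      = q ^ nat (int k) * q ^ nat (j * (5 * j + 3) div 2)"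
    using nat_power_combine[OF half_5_3_nonneg[of "- 1 - j"] assms(1), of q]
      nat_power_combine[OF _ half_5_3_nonneg[of j], of "int k" q] by simp
  thus ?thesis by (simp add: bressoud_b_def)
qed

context
  fixes q :: complex
  assumes q: "norm q < 1"
begin

text \<open>Pascal's rule leaves the extra series \<open>?R\<close>, in which the terms at j and
  -1-j cancel.\<close>

lemma bressoud_series_even:
  "qbinom_series q (bressoud_a q) (2 * k + 1) (int k) = qbinom_series q (bressoud_a q) (2 * k) (int k)"
proof -
  let ?c = "\<lambda>j. bressoud_a q j * q ^ nat (int (Suc (2 * k)) - int k + 2 * j)"
  let ?R = "qbinom_series q ?c (2 * k) (int k - 1)"
  have "?R = qbinom_series q (\<lambda>j. ?c (- 1 - j)) (2 * k) (int (2 * k) - (int k - 1) - 2)"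
    by (rule qbinom_series_reflect)
  also have "\<dots> = qbinom_series q (\<lambda>j. ?c (- 1 - j)) (2 * k) (int k - 1)"
    by simp
  also have "\<dots> = qbinom_series q (\<lambda>j. - 1 * ?c j) (2 * k) (int k - 1)"
  proof (rule qbinom_series_cong)
    fix j assume "0 \<le> int k - 1 - 2 * j" "int k - 1 - 2 * j \<le> int (2 * k)"
    thus "?c (- 1 - j) = - 1 * ?c j"
      by (subst bressoud_a_reflect[where e' = "int (Suc (2 * k)) - int k + 2 * j"]) auto
  qed
  also have "\<dots> = - 1 * ?R"
    by (rule qbinom_series_cmult)
  finally have "?R = 0" by simp
  thus ?thesis
    using qbinom_series_pascal'[OF q, of "bressoud_a q" "2 * k" "int k"] by simp
qed

text \<open>Pascal's rule creates the weights q^(k+1-2j), and the reflection of j to -j converts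
  them into the companion coefficients. The matching recurrence for the sums over n is
  \<open>sum_qbinom_rec\<close>.\<close>

lemma bressoud_series_rec_a:
  "qbinom_series q (bressoud_a q) (2 * Suc k) (int (Suc k))
     = qbinom_series q (bressoud_a q) (2 * k + 1) (int k)
       + q ^ Suc k * qbinom_series q (bressoud_b q) (2 * k + 1) (int k)"
proof -
  let ?c = "\<lambda>j. bressoud_a q j * q ^ nat (int (Suc k) - 2 * j)"
  have "qbinom_series q ?c (2 * k + 1) (int (Suc k))
      = qbinom_series q (\<lambda>j. ?c (- j)) (2 * k + 1) (int (2 * k + 1) - int (Suc k))"
    by (rule qbinom_series_uminus)
  also have "\<dots> = qbinom_series q (\<lambda>j. ?c (- j)) (2 * k + 1) (int k)"
    by simp
  also have "\<dots> = qbinom_series q (\<lambda>j. q ^ Suc k * bressoud_b q j) (2 * k + 1) (int k)"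
  proof (rule qbinom_series_cong)
    fix j assume "0 \<le> int k - 2 * j" "int k - 2 * j \<le> int (2 * k + 1)"
    thus "?c (- j) = q ^ Suc k * bressoud_b q j"
      by (intro bressoud_a_shift) auto
  qed
  also have "\<dots> = q ^ Suc k * qbinom_series q (bressoud_b q) (2 * k + 1) (int k)"
    by (rule qbinom_series_cmult)
  finally show ?thesis
    using qbinom_series_pascal[OF q, of "bressoud_a q" "2 * k + 1" "int (Suc k)"] by simp
qed

text \<open>Two Pascal steps lead from the top entry 2k+3 down to 2k+1. The first correction becomes
  the \<open>bressoud_a\<close> series by j to -j; the second reproduces the
  \<open>bressoud_b\<close> series with a minus sign by j to -1-j, whence the factor 1 -
  q^(k+1).\<close>

lemma bressoud_series_rec_b:
  "qbinom_series q (bressoud_b q) (2 * Suc k + 1) (int (Suc k))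
     = (1 - q ^ Suc k) * qbinom_series q (bressoud_b q) (2 * k + 1) (int k)
       + q ^ Suc k * qbinom_series q (bressoud_a q) (2 * Suc k) (int (Suc k))"
proof -
  let ?c = "\<lambda>j. bressoud_b q j * q ^ nat (int (Suc k) - 2 * j)"
  have "qbinom_series q ?c (2 * Suc k) (int (Suc k))
      = qbinom_series q (\<lambda>j. ?c (- j)) (2 * Suc k) (int (2 * Suc k) - int (Suc k))"
    by (rule qbinom_series_uminus)
  also have "\<dots> = qbinom_series q (\<lambda>j. ?c (- j)) (2 * Suc k) (int (Suc k))"
    by simp
  also have "\<dots> = qbinom_series q (\<lambda>j. q ^ Suc k * bressoud_a q j) (2 * Suc k) (int (Suc k))"
  proof (rule qbinom_series_cong)
    fix j assume "0 \<le> int (Suc k) - 2 * j" "int (Suc k) - 2 * j \<le> int (2 * Suc k)"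
    thus "?c (- j) = q ^ Suc k * bressoud_a q j"
      by (intro bressoud_b_shift) auto
  qed
  also have "\<dots> = q ^ Suc k * qbinom_series q (bressoud_a q) (2 * Suc k) (int (Suc k))"
    by (rule qbinom_series_cmult)
  finally have 1: "qbinom_series q ?c (2 * Suc k) (int (Suc k)) = \<dots>" .

  let ?d = "\<lambda>j. bressoud_b q j * q ^ nat (int (Suc (2 * k + 1)) - int k + 2 * j)"
  have "qbinom_series q ?d (2 * k + 1) (int k - 1)
      = qbinom_series q (\<lambda>j. ?d (- 1 - j)) (2 * k + 1) (int (2 * k + 1) - (int k - 1) - 2)"
    by (rule qbinom_series_reflect)
  also have "\<dots> = qbinom_series q (\<lambda>j. ?d (- 1 - j)) (2 * k + 1) (int k)"
    by simp
  also have "\<dots> = qbinom_series q (\<lambda>j. - (q ^ Suc k) * bressoud_b q j) (2 * k + 1) (int k)"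
  proof (rule qbinom_series_cong)
    fix j assume "0 \<le> int k - 2 * j" "int k - 2 * j \<le> int (2 * k + 1)"
    thus "?d (- 1 - j) = - (q ^ Suc k) * bressoud_b q j"
      by (subst bressoud_b_reflect[where k = "Suc k"]) auto
  qed
  also have "\<dots> = - (q ^ Suc k) * qbinom_series q (bressoud_b q) (2 * k + 1) (int k)"
    by (rule qbinom_series_cmult)
  finally have 2: "qbinom_series q ?d (2 * k + 1) (int k - 1) = \<dots>" .

  have "qbinom_series q (bressoud_b q) (2 * Suc k + 1) (int (Suc k))
      = qbinom_series q (bressoud_b q) (2 * Suc k) (int k)
        + qbinom_series q ?c (2 * Suc k) (int (Suc k))"
    using qbinom_series_pascal[OF q, of "bressoud_b q" "2 * Suc k" "int (Suc k)"] by simp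
  also have "qbinom_series q (bressoud_b q) (2 * Suc k) (int k)
      = qbinom_series q (bressoud_b q) (2 * k + 1) (int k)
        + qbinom_series q ?d (2 * k + 1) (int k - 1)"
    using qbinom_series_pascal'[OF q, of "bressoud_b q" "2 * k + 1" "int k"] by simp
  finally show ?thesis
    unfolding 1 2 by (simp add: algebra_simps)
qed

section \<open>The same recurrences for the sums over n\<close>

lemma sum_qbinom_rec:
  "(\<Sum>n\<le>Suc k. q ^ n\<^sup>2 * qbinom q (Suc k) n)
     = (\<Sum>n\<le>k. q ^ n\<^sup>2 * qbinom q k n) + q ^ Suc k * (\<Sum>n\<le>k. q ^ (n\<^sup>2 + n) * qbinom q k n)"
proof -
  have "(\<Sum>n\<le>Suc k. q ^ n\<^sup>2 * qbinom q (Suc k) n)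
      = 1 + (\<Sum>n\<le>k. q ^ (Suc n)\<^sup>2 * qbinom q (Suc k) (Suc n))"
    unfolding sum.atMost_Suc_shift using q by simp
  also have "(\<Sum>n\<le>k. q ^ (Suc n)\<^sup>2 * qbinom q (Suc k) (Suc n))
      = (\<Sum>n\<le>k. q ^ (Suc n)\<^sup>2 * qbinom q k (Suc n) + q ^ Suc k * (q ^ (n\<^sup>2 + n) * qbinom q k n))"
  proof (intro sum.cong refl)
    fix n assume "n \<in> {..k}"
    hence n: "n \<le> k" by simp
    hence "(Suc n)\<^sup>2 + (k - n) = Suc k + (n\<^sup>2 + n)"
      by (simp add: power2_eq_square)
    hence "q ^ (Suc n)\<^sup>2 * q ^ (k - n) = q ^ Suc k * q ^ (n\<^sup>2 + n)"
      by (metis power_add)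
    thus "q ^ (Suc n)\<^sup>2 * qbinom q (Suc k) (Suc n)
        = q ^ (Suc n)\<^sup>2 * qbinom q k (Suc n) + q ^ Suc k * (q ^ (n\<^sup>2 + n) * qbinom q k n)"
      unfolding qbinom_pascal'[OF q n] by (simp add: ring_distribs del: power_Suc flip: mult.assoc)
  qed
  also have "1 + \<dots> = (\<Sum>n\<le>Suc k. q ^ n\<^sup>2 * qbinom q k n)
      + q ^ Suc k * (\<Sum>n\<le>k. q ^ (n\<^sup>2 + n) * qbinom q k n)"
    unfolding sum.atMost_Suc_shift[of "\<lambda>n. q ^ n\<^sup>2 * qbinom q k n"] sum.distrib sum_distrib_left
    using q by simp
  finally show ?thesis by (simp add: qbinom_eq_0)
qed

text \<open>The two Pascal rules, one for each sum at k + 1, express both sums through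
  \<open>?B\<close> and the auxiliary \<open>?C\<close>; eliminating \<open>?C\<close> gives the
  relation.\<close>

lemma sum_qbinom_rec':
  "(\<Sum>n\<le>Suc k. q ^ (n\<^sup>2 + n) * qbinom q (Suc k) n)
     = (1 - q ^ Suc k) * (\<Sum>n\<le>k. q ^ (n\<^sup>2 + n) * qbinom q k n)
       + q ^ Suc k * (\<Sum>n\<le>Suc k. q ^ n\<^sup>2 * qbinom q (Suc k) n)"
proof -
  let ?C = "\<Sum>n\<le>k. q ^ (n\<^sup>2 + 2 * n) * qbinom q k n"
  let ?B = "\<Sum>n\<le>k. q ^ (n\<^sup>2 + n) * qbinom q k n"
  have shift: "(\<Sum>n\<le>Suc k. q ^ (n\<^sup>2 + n) * qbinom q k n)
      = 1 + (\<Sum>n\<le>k. q ^ ((Suc n)\<^sup>2 + Suc n) * qbinom q k (Suc n))"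
    unfolding sum.atMost_Suc_shift using q by simp
  hence B: "?B = 1 + (\<Sum>n\<le>k. q ^ ((Suc n)\<^sup>2 + Suc n) * qbinom q k (Suc n))"
    by (simp add: qbinom_eq_0)

  have "(\<Sum>n\<le>Suc k. q ^ (n\<^sup>2 + n) * qbinom q (Suc k) n)
      = 1 + (\<Sum>n\<le>k. q ^ ((Suc n)\<^sup>2 + Suc n) * qbinom q (Suc k) (Suc n))"
    unfolding sum.atMost_Suc_shift using q by simp
  also have "(\<Sum>n\<le>k. q ^ ((Suc n)\<^sup>2 + Suc n) * qbinom q (Suc k) (Suc n))
      = (\<Sum>n\<le>k. q ^ ((Suc n)\<^sup>2 + Suc n) * qbinom q k (Suc n)
            + q ^ (k + 2) * (q ^ (n\<^sup>2 + 2 * n) * qbinom q k n))"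
  proof (intro sum.cong refl)
    fix n assume "n \<in> {..k}"
    hence n: "n \<le> k" by simp
    hence "(Suc n)\<^sup>2 + Suc n + (k - n) = (k + 2) + (n\<^sup>2 + 2 * n)"
      by (simp add: power2_eq_square)
    hence "q ^ ((Suc n)\<^sup>2 + Suc n) * q ^ (k - n) = q ^ (k + 2) * q ^ (n\<^sup>2 + 2 * n)"
      by (metis power_add)
    thus "q ^ ((Suc n)\<^sup>2 + Suc n) * qbinom q (Suc k) (Suc n)
        = q ^ ((Suc n)\<^sup>2 + Suc n) * qbinom q k (Suc n) + q ^ (k + 2) * (q ^ (n\<^sup>2 + 2 * n) * qbinom q k n)"
      unfolding qbinom_pascal'[OF q n] by (simp add: ring_distribs del: power_Suc flip: mult.assoc)
  qed
  also have "1 + \<dots> = ?B + q ^ (k + 2) * ?C"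
    unfolding B sum.distrib sum_distrib_left by simp
  finally have 1: "(\<Sum>n\<le>Suc k. q ^ (n\<^sup>2 + n) * qbinom q (Suc k) n) = ?B + q ^ (k + 2) * ?C" .

  have "(\<Sum>n\<le>Suc k. q ^ n\<^sup>2 * qbinom q (Suc k) n)
      = 1 + (\<Sum>n\<le>k. q ^ (Suc n)\<^sup>2 * qbinom q (Suc k) (Suc n))"
    unfolding sum.atMost_Suc_shift using q by simp
  also have "(\<Sum>n\<le>k. q ^ (Suc n)\<^sup>2 * qbinom q (Suc k) (Suc n))
      = (\<Sum>n\<le>k. q ^ ((Suc n)\<^sup>2 + Suc n) * qbinom q k (Suc n)
            + q * (q ^ (n\<^sup>2 + 2 * n) * qbinom q k n))"
  proof (intro sum.cong refl)
    fix n
    have "(Suc n)\<^sup>2 = Suc (n\<^sup>2 + 2 * n)" by (simp add: power2_eq_square)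
    hence "q ^ (Suc n)\<^sup>2 = q * q ^ (n\<^sup>2 + 2 * n)" by simp
    thus "q ^ (Suc n)\<^sup>2 * qbinom q (Suc k) (Suc n)
        = q ^ ((Suc n)\<^sup>2 + Suc n) * qbinom q k (Suc n) + q * (q ^ (n\<^sup>2 + 2 * n) * qbinom q k n)"
      unfolding qbinom_pascal[OF q] power_add[of q "(Suc n)\<^sup>2" "Suc n"]
      by (simp add: ring_distribs del: power_Suc)
  qed
  also have "1 + \<dots> = ?B + q * ?C"
    unfolding B sum.distrib sum_distrib_left by simp
  finally have 2: "(\<Sum>n\<le>Suc k. q ^ n\<^sup>2 * qbinom q (Suc k) n) = ?B + q * ?C" .
  show ?thesis unfolding 1 2 by (simp add: algebra_simps)
qed

theorem bressoud_identity:
  "(\<Sum>n\<le>k. q ^ n\<^sup>2 * qbinom q k n) = qbinom_series q (bressoud_a q) (2 * k + 1) (int k)"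
proof -
  have "(\<Sum>n\<le>k. q ^ n\<^sup>2 * qbinom q k n) = qbinom_series q (bressoud_a q) (2 * k + 1) (int k)
    \<and> (\<Sum>n\<le>k. q ^ (n\<^sup>2 + n) * qbinom q k n) = qbinom_series q (bressoud_b q) (2 * k + 1) (int k)"
  proof (induction k)
    case 0
    have "qbinom_series q c 1 0 = c 0" for c
    proof -
      have "((\<lambda>j. c j * qbinom_int q 1 (0 - 2 * j)) has_sum c 0) UNIV"
        by (rule has_sum_finite_neutralI[of "{0}"])
           (use q in \<open>auto simp: qbinom_int_def qbinom_def qpoch_def\<close>)
      thus ?thesis unfolding qbinom_series_def by (rule infsumI)
    qed
    thus ?case using q by (simp add: bressoud_a_def bressoud_b_def alt_def)
  next
    case (Suc k)
    \<comment> \<open>The recurrence lands on the even top entry 2k+2;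
      \<open>bressoud_series_even\<close> raises it to 2k+3 afterwards.\<close>
    have A: "(\<Sum>n\<le>Suc k. q ^ n\<^sup>2 * qbinom q (Suc k) n)
        = qbinom_series q (bressoud_a q) (2 * Suc k) (int (Suc k))"
      using Suc unfolding sum_qbinom_rec bressoud_series_rec_a by simp
    show ?case
      using Suc A unfolding sum_qbinom_rec' bressoud_series_rec_b bressoud_series_even by simp
  qed
  thus ?thesis by blast
qed

end

section \<open>The Jacobi triple product\<close>

text \<open>The terms of Ramanujan's theta function \<open>f(-x, -y)\<close>. In this form all exponents are natural
  numbers, so \<open>q = 0\<close> needs no separate treatment.\<close>
definition theta_term :: "complex \<Rightarrow> complex \<Rightarrow> int \<Rightarrow> complex" where
  "theta_term x y j = alt j * x ^ nat (j * (j + 1) div 2) * y ^ nat (j * (j - 1) div 2)"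

lemma two_times_triangle: "2 * (j * (j + 1) div 2) = j * (j + 1)" for j :: int
  by (rule dvd_mult_div_cancel) (auto simp: even_mult_iff)

lemma two_times_triangle': "2 * (j * (j - 1) div 2) = j * (j - 1)" for j :: int
  by (rule dvd_mult_div_cancel) (auto simp: even_mult_iff)

lemma triangle_nonneg: "j * (j + 1) div 2 \<ge> 0" for j :: int
  using int_mult_linear_nonneg[of 1 1 j] by simp

lemma triangle_nonneg': "j * (j - 1) div 2 \<ge> 0" for j :: int
  using int_mult_linear_nonneg[of 1 1 "- j"] by (simp add: algebra_simps)

lemma theta_term_swap: "theta_term y x (- j) = theta_term x y j"
proof -
  have "- j * (- j + 1) = j * (j - 1)" "- j * (- j - 1) = j * (j + 1)"
    by (simp_all add: algebra_simps)
  thus ?thesis by (simp add: theta_term_def mult_ac)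
qed

text \<open>Consecutive terms have ratio -x^j y^(j-1) = -x p^(j-1), and the power of p on the left
  removes the dependence on j. The case split at j = 1 keeps all exponents natural.\<close>

lemma theta_term_pred:
  fixes x y p :: complex
  assumes p: "p = x * y" and j: "j \<le> int M + 1"
  shows "theta_term x y j * p ^ nat (int M + 1 - j) = - (x * p ^ M) * theta_term x y (j - 1)"
proof -
  let ?a = "\<lambda>j::int. j * (j + 1) div 2" and ?b = "\<lambda>j::int. j * (j - 1) div 2"
  have a: "?a j = ?a (j - 1) + j" and b: "?b j = ?b (j - 1) + (j - 1)"
    using two_times_triangle[of j] two_times_triangle[of "j - 1"]
      two_times_triangle'[of j] two_times_triangle'[of "j - 1"]
    by (simp_all add: algebra_simps)
  have alt: "alt j = - alt (j - 1)" by (simp add: alt_def)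
  show ?thesis
  proof (cases "j \<ge> 1")
    case True
    have 1: "x ^ nat (?a j) = x ^ nat (?a (j - 1)) * (x * x ^ nat (j - 1))"
      using nat_power_combine[OF triangle_nonneg[of "j - 1"], of j x] True a
        nat_power_combine[of 1 "j - 1" x] by simp
    have 2: "y ^ nat (?b j) = y ^ nat (?b (j - 1)) * y ^ nat (j - 1)"
      using nat_power_combine[OF triangle_nonneg'[of "j - 1"], of "j - 1" y] True b by simp
    have 3: "p ^ M = x ^ nat (j - 1) * y ^ nat (j - 1) * p ^ nat (int M + 1 - j)"
      using nat_power_combine[of "j - 1" "int M + 1 - j" p] True j
      by (simp add: p power_mult_distrib)
    show ?thesis unfolding theta_term_def 1 2 3 alt by (simp add: mult_ac)
  next
    case False
    have 1: "x ^ nat (?a (j - 1)) = x ^ nat (?a j) * x ^ nat (- j)"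
      using nat_power_combine[OF triangle_nonneg[of j], of "- j" x] False a by simp
    have 2: "y ^ nat (?b (j - 1)) = y ^ nat (?b j) * (y * y ^ nat (- j))"
      using nat_power_combine[OF triangle_nonneg'[of j], of "1 - j" y] False b
        nat_power_combine[of 1 "- j" y] by simp
    have "p ^ nat (int M + 1 - j) = p ^ nat (int M) * (p ^ nat 1 * p ^ nat (- j))"
      using nat_power_combine[of "int M" "1 - j" p] nat_power_combine[of 1 "- j" p] False
      by (simp add: algebra_simps)
    hence 3: "p ^ nat (int M + 1 - j) = p ^ M * (x * y) * (x ^ nat (- j) * y ^ nat (- j))"
      by (simp add: p power_mult_distrib)
    show ?thesis unfolding theta_term_def 1 2 3 alt by (simp add: mult_ac)
  qed
qed

text \<open>Pascal's rule gives the old sum plus its shift by one in j;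
  \<open>theta_term_pred\<close> turns the shift into multiplication by -x p^M.\<close>

lemma finite_triple_product_step:
  fixes x y p :: complex
  assumes p: "p = x * y" "norm p < 1"
    and sum: "((\<lambda>j. theta_term x y j * qbinom_int p (M + N) (int N + j)) has_sum S) UNIV"
  shows "((\<lambda>j. theta_term x y j * qbinom_int p (Suc M + N) (int N + j))
            has_sum S * (1 - x * p ^ M)) UNIV"
proof -
  have "((\<lambda>j. theta_term x y (j - 1) * qbinom_int p (M + N) (int N + (j - 1))) has_sum S) UNIV"
    using sum by (subst has_sum_reindex_bij_witness[of UNIV "\<lambda>j. j + 1" "\<lambda>j. j - 1" UNIV]) auto
  hence "((\<lambda>j. theta_term x y j * qbinom_int p (M + N) (int N + j)
        + - (x * p ^ M) * (theta_term x y (j - 1) * qbinom_int p (M + N) (int N + (j - 1))))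
      has_sum S + - (x * p ^ M) * S) UNIV"
    by (intro has_sum_add sum has_sum_cmult_right)
  moreover have "theta_term x y j * qbinom_int p (M + N) (int N + j)
        + - (x * p ^ M) * (theta_term x y (j - 1) * qbinom_int p (M + N) (int N + (j - 1)))
      = theta_term x y j * qbinom_int p (Suc M + N) (int N + j)" for j
  proof (cases "j \<le> int M + 1")
    case True
    have "int (Suc (M + N)) - (int N + j) = int M + 1 - j" "int N + j - 1 = int N + (j - 1)"
      by simp_all
    hence pascal: "qbinom_int p (Suc M + N) (int N + j) = qbinom_int p (M + N) (int N + j)
        + p ^ nat (int M + 1 - j) * qbinom_int p (M + N) (int N + (j - 1))"
      using qbinom_int_pascal'[OF p(2), of "M + N" "int N + j"] by (simp only: add_Suc)
    show ?thesis
      by (simp only: pascal distrib_left mult.assoc[symmetric] theta_term_pred[OF p(1) True])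
  next
    case False
    thus ?thesis by (simp add: qbinom_int_eq_0)
  qed
  moreover have "S + - (x * p ^ M) * S = S * (1 - x * p ^ M)"
    by (simp add: algebra_simps)
  ultimately show ?thesis by simp
qed

lemma finite_triple_product_swap:
  assumes "((\<lambda>j. theta_term x y j * qbinom_int p (M + N) (int N + j)) has_sum S) UNIV"
  shows "((\<lambda>j. theta_term y x j * qbinom_int p (N + M) (int M + j)) has_sum S) UNIV"
proof -
  have "theta_term x y (- j) * qbinom_int p (M + N) (int N + - j)
      = theta_term y x j * qbinom_int p (N + M) (int M + j)" for j
    using qbinom_int_symmetric[of p "M + N" "int M + j"] theta_term_swap[of x y j]
    by (simp add: add.commute)
  thus ?thesis
    using assms by (subst has_sum_reindex_bij_witness[of UNIV uminus uminus UNIV]) auto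
qed

text \<open>Cauchy's finite form of the triple product. The factors in x are built at N = 0; the
  swap of x and y then lets the same step add the factors in y.\<close>

lemma finite_triple_product:
  fixes x y p :: complex
  assumes p: "p = x * y" "norm p < 1"
  shows "((\<lambda>j. theta_term x y j * qbinom_int p (M + N) (int N + j))
            has_sum qpoch x p M * qpoch y p N) UNIV"
proof (induction N)
  case 0
  show ?case
  proof (induction M)
    case 0
    show ?case
      by (rule has_sum_finite_neutralI[of "{0}"])
         (auto simp: qbinom_int_def qbinom_def theta_term_def alt_def)
  next
    case (Suc M)
    thus ?case
      using finite_triple_product_step[OF p, of M 0] by (simp add: qpoch_Suc)
  qed
next
  case (Suc N)
  have "((\<lambda>j. theta_term y x j * qbinom_int p (Suc N + M) (int M + j))
          has_sum qpoch x p M * qpoch y p N * (1 - y * p ^ N)) UNIV"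
    by (rule finite_triple_product_step[OF _ p(2) finite_triple_product_swap[OF Suc]])
       (simp add: p mult.commute)
  thus ?case
    using finite_triple_product_swap[of y x p "Suc N" M] by (simp add: qpoch_Suc mult.assoc)
qed

section \<open>From the finite to the infinite triple product\<close>

lemma abs_le_square_int: "\<bar>j\<bar> \<le> j * j" for j :: int
proof (cases "j = 0")
  case False
  hence "\<bar>j\<bar> * 1 \<le> \<bar>j\<bar> * \<bar>j\<bar>" by (intro mult_left_mono) auto
  thus ?thesis by simp
qed simp

lemma summable_on_int_power:
  fixes r :: real
  assumes "0 \<le> r" "r < 1"
  shows "(\<lambda>j::int. r ^ nat \<bar>j\<bar>) summable_on UNIV"
proof -
  have r: "(\<lambda>n::nat. r ^ n) summable_on UNIV"
    by (rule norm_summable_imp_summable_on) (use assms in simp)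
  have "(\<lambda>j::int. r ^ nat \<bar>j\<bar>) summable_on range int"
    by (subst summable_on_reindex) (use r in \<open>auto simp: o_def\<close>)
  moreover have "(\<lambda>j::int. r ^ nat \<bar>j\<bar>) summable_on range (\<lambda>n. - int n)"
    by (subst summable_on_reindex) (use r in \<open>auto simp: o_def inj_on_def\<close>)
  ultimately have "(\<lambda>j::int. r ^ nat \<bar>j\<bar>) summable_on (range int \<union> range (\<lambda>n. - int n))"
    by (rule summable_on_union)
  moreover have "range int \<union> range (\<lambda>n. - int n) = UNIV"
    by (metis (no_types, lifting) UNIV_eq_I UnI1 UnI2 int_cases2 rangeI)
  ultimately show ?thesis by simp
qed

lemma bij_int_decode: "bij int_decode"
  by (metis bij_betw_def inj_int_decode surj_int_decode)

lemma qbinom_central_tendsto: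
  assumes "norm p < 1"
  shows "(\<lambda>n. qbinom_int p (n + n) (int n + j)) \<longlonglongrightarrow> 1 / qpoch_inf p p"
proof -
  let ?P = "qpoch p p"
  have dbl: "filterlim (\<lambda>n::nat. n + n) at_top at_top"
    by (rule filterlim_at_top_mono[OF filterlim_ident]) auto
  have plus: "filterlim (\<lambda>n. nat (int n + i)) at_top at_top" for i
    unfolding filterlim_at_top
  proof
    fix Z
    show "eventually (\<lambda>n. nat (int n + i) \<ge> Z) sequentially"
      using eventually_ge_at_top[of "Z + nat \<bar>i\<bar>"] by eventually_elim auto
  qed
  note lim = qpoch_tendsto[OF assms, of p]
  have "(\<lambda>n. ?P (n + n) / (?P (nat (int n + j)) * ?P (nat (int n + - j))))
      \<longlonglongrightarrow> qpoch_inf p p / (qpoch_inf p p * qpoch_inf p p)"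
    by (intro tendsto_intros filterlim_compose[OF lim dbl] filterlim_compose[OF lim plus])
       (simp add: qpoch_inf_self_nonzero[OF assms])
  hence "(\<lambda>n. ?P (n + n) / (?P (nat (int n + j)) * ?P (nat (int n + - j)))) \<longlonglongrightarrow> 1 / qpoch_inf p p"
    using qpoch_inf_self_nonzero[OF assms] by simp
  moreover have "eventually (\<lambda>n. ?P (n + n) / (?P (nat (int n + j)) * ?P (nat (int n + - j)))
      = qbinom_int p (n + n) (int n + j)) sequentially"
    using eventually_ge_at_top[of "nat \<bar>j\<bar>"]
  proof eventually_elim
    case (elim n)
    have "n + n - nat (int n + j) = nat (int n + - j)" "nat (int n + j) \<le> n + n" "int n + j \<ge> 0"
      using elim by auto
    thus ?case by (simp add: qbinom_int_def qbinom_def)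
  qed
  ultimately show ?thesis by (rule Lim_transform_eventually)
qed

theorem jacobi_triple_product:
  fixes x y p :: complex
  assumes "norm x < 1" "norm y < 1" and p: "p = x * y"
  shows "(theta_term x y has_sum qpoch_inf p p * qpoch_inf x p * qpoch_inf y p) UNIV"
proof -
  define r where "r = max (norm x) (norm y)"
  have r: "0 \<le> r" "r < 1" "norm x \<le> r" "norm y \<le> r"
    using assms by (auto simp: r_def le_max_iff_disj)
  have "norm p \<le> norm x * 1"
    unfolding p norm_mult using assms by (intro mult_left_mono) auto
  hence np: "norm p < 1" using assms by simp
  obtain C where C: "\<And>n k. norm (qbinom_int p n k) \<le> C" "C \<ge> 0"
    using qbinom_int_bounded[OF np] by blast
  have bound: "norm (theta_term x y j) \<le> r ^ nat \<bar>j\<bar>" for j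
  proof -
    let ?a = "j * (j + 1) div 2" and ?b = "j * (j - 1) div 2"
    \<comment> \<open>Abstract A and B keep integer division out of the arithmetic. The two
      exponents add up to j^2, which is at least |j|, so a geometric majorant is enough.\<close>
    have "A + B = j * j" if "2 * A = j * (j + 1)" "2 * B = j * (j - 1)" for A B
      using that by (simp add: algebra_simps)
    from this[OF two_times_triangle two_times_triangle'] have "?a + ?b = j * j" .
    moreover note abs_le_square_int[of j]
    ultimately have "nat \<bar>j\<bar> \<le> nat ?a + nat ?b"
      using triangle_nonneg[of j] triangle_nonneg'[of j] by linarith
    have "norm (theta_term x y j) = norm x ^ nat ?a * norm y ^ nat ?b"
      by (simp add: theta_term_def norm_mult norm_power alt_def)
    also have "\<dots> \<le> r ^ nat ?a * r ^ nat ?b"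
      using r by (intro mult_mono power_mono) auto
    also have "\<dots> = r ^ (nat ?a + nat ?b)" by (simp add: power_add)
    also have "\<dots> \<le> r ^ nat \<bar>j\<bar>"
      using r \<open>nat \<bar>j\<bar> \<le> nat ?a + nat ?b\<close> by (intro power_decreasing) auto
    finally show ?thesis .
  qed
  have "((\<lambda>j. theta_term x y j * (1 / qpoch_inf p p)) has_sum qpoch_inf x p * qpoch_inf y p) UNIV"
  proof (rule tannery_has_sum[OF bij_int_decode, where M = "\<lambda>j. r ^ nat \<bar>j\<bar> * C"
        and f = "\<lambda>n j. theta_term x y j * qbinom_int p (n + n) (int n + j)"
        and s = "\<lambda>n. qpoch x p n * qpoch y p n"])
    show "(\<lambda>n. theta_term x y j * qbinom_int p (n + n) (int n + j))
        \<longlonglongrightarrow> theta_term x y j * (1 / qpoch_inf p p)" for j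
      by (intro tendsto_intros qbinom_central_tendsto np)
    show "norm (theta_term x y j * qbinom_int p (n + n) (int n + j)) \<le> r ^ nat \<bar>j\<bar> * C" for n j
      unfolding norm_mult using bound C r by (intro mult_mono) auto
    show "(\<lambda>j. r ^ nat \<bar>j\<bar> * C) summable_on UNIV"
      by (intro summable_on_cmult_left summable_on_int_power r)
    show "(\<lambda>n. qpoch x p n * qpoch y p n) \<longlonglongrightarrow> qpoch_inf x p * qpoch_inf y p"
      by (intro tendsto_intros qpoch_tendsto np)
  qed (rule finite_triple_product[OF p np])
  from has_sum_cmult_right[OF this, of "qpoch_inf p p"] show ?thesis
    using qpoch_inf_self_nonzero[OF np] by (simp add: mult_ac)
qed

section \<open>The Bailey chain\<close>

text \<open>The part of the summand that is free of n, with k(k+1) in place of 2T(k).\<close>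

definition bailey_weight :: "complex \<Rightarrow> nat \<Rightarrow> nat \<Rightarrow> complex" where
  "bailey_weight q m k = q ^ (k * (k + 1) + (m + k) * (m + k + 1)) / (qpoch q q m * qpoch q q (2 * k + 1))"

lemma summable_on_Times_nonneg:
  fixes f :: "'a \<Rightarrow> real" and g :: "'b \<Rightarrow> real"
  assumes "f summable_on UNIV" "g summable_on UNIV" "\<And>x. f x \<ge> 0" "\<And>y. g y \<ge> 0"
  shows "(\<lambda>(x, y). f x * g y) summable_on UNIV"
proof -
  have "(\<lambda>(x, y). f x * g y) summable_on (UNIV \<times> UNIV)"
  proof (rule summable_on_SigmaI)
    show "((\<lambda>y. case (x, y) of (x, y) \<Rightarrow> f x * g y) has_sum f x * infsum g UNIV) UNIV" for x
      using assms by (simp add: has_sum_cmult_right)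
    show "(\<lambda>x. f x * infsum g UNIV) summable_on UNIV"
      by (intro summable_on_cmult_left assms)
  qed (use assms in auto)
  thus ?thesis by simp
qed

context
  fixes q :: complex
  assumes q: "norm q < 1"
begin

lemma bailey_weight_bounded:
  obtains C where "\<And>m k. norm (bailey_weight q m k) \<le> C * (norm q ^ m * norm q ^ k)" "C \<ge> 0"
proof -
  obtain C where C: "\<And>n. norm (1 / qpoch q q n) \<le> C" "C \<ge> 1"
    using qpoch_inverse_bounded[OF q] by blast
  have "norm (bailey_weight q m k) \<le> C * C * (norm q ^ m * norm q ^ k)" for m k
  proof -
    have "norm (bailey_weight q m k) = norm (1 / qpoch q q m) * norm (1 / qpoch q q (2 * k + 1))
        * norm q ^ (k * (k + 1) + (m + k) * (m + k + 1))"
      by (simp add: bailey_weight_def norm_mult norm_divide norm_power)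
    also have "\<dots> \<le> C * C * norm q ^ (m + k)"
      using C q by (intro mult_mono power_decreasing) auto
    finally show ?thesis by (simp add: power_add)
  qed
  thus ?thesis using C by (intro that[of "C * C"]) auto
qed

text \<open>The weight decays like |q|^(m+k), so a further factor may depend on m and k as long as
  its majorant does not. With a third index of type unit, int or nat this justifies the
  rearrangements below.\<close>

lemma summable_bailey_weight_mult:
  fixes c :: "nat \<Rightarrow> nat \<Rightarrow> 'a \<Rightarrow> complex"
  assumes "M summable_on UNIV" "\<And>m k j. norm (c m k j) \<le> M j"
  shows "(\<lambda>((m, k), j). bailey_weight q m k * c m k j) summable_on UNIV"
proof -
  obtain C where C: "\<And>m k. norm (bailey_weight q m k) \<le> C * (norm q ^ m * norm q ^ k)" "C \<ge> 0"
    using bailey_weight_bounded by blast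
  have M: "M j \<ge> 0" for j
    using assms(2)[of 0 0 j] norm_ge_zero order_trans by blast
  have "(\<lambda>(m, k). norm q ^ m * norm q ^ k) summable_on UNIV"
    by (intro summable_on_Times_nonneg summable_on_norm_power q) auto
  hence "(\<lambda>(mk, j). (case mk of (m, k) \<Rightarrow> norm q ^ m * norm q ^ k) * M j) summable_on UNIV"
    by (rule summable_on_Times_nonneg) (use assms M in auto)
  hence *: "(\<lambda>x. C * (case x of (mk, j) \<Rightarrow> (case mk of (m, k) \<Rightarrow> norm q ^ m * norm q ^ k) * M j))
      summable_on UNIV"
    by (rule summable_on_cmult_right)
  have "(\<lambda>x. norm (case x of ((m, k), j) \<Rightarrow> bailey_weight q m k * c m k j)) summable_on UNIV"
  proof (rule Infinite_Sum.abs_summable_on_comparison_test'[OF *])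
    fix x :: "(nat \<times> nat) \<times> 'a"
    obtain m k j where x: "x = ((m, k), j)" by (metis prod.collapse)
    have "norm (bailey_weight q m k) * norm (c m k j) \<le> C * (norm q ^ m * norm q ^ k) * M j"
      using C M assms(2) by (intro mult_mono) auto
    thus "norm (case x of ((m, k), j) \<Rightarrow> bailey_weight q m k * c m k j)
        \<le> C * (case x of (mk, j) \<Rightarrow> (case mk of (m, k) \<Rightarrow> norm q ^ m * norm q ^ k) * M j)"
      by (simp add: x norm_mult mult.assoc)
  qed
  from Infinite_Sum.abs_summable_summable[OF this] show ?thesis by (simp add: case_prod_unfold)
qed

text \<open>Dividing \<open>qvandermonde_limit\<close> by (q)_N gives the shape that occurs in the
  Bailey chain, where (q)_{N-s} comes from (q)_m.\<close>

lemma qvandermonde_limit_symmetric: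
  "(\<Sum>s\<le>N. q ^ (s * (s + c)) / (qpoch q q (N - s) * qpoch q q s * qpoch q q (s + c)))
     = 1 / (qpoch q q N * qpoch q q (N + c))"
proof -
  have "(\<Sum>s\<le>N. q ^ (s * (s + c)) / (qpoch q q (N - s) * qpoch q q s * qpoch q q (s + c)))
      = (\<Sum>s\<le>N. q ^ (s * (s + c)) * qbinom q N s / qpoch q q (s + c)) / qpoch q q N"
    unfolding sum_divide_distrib using qpoch_self_nonzero[OF q]
    by (intro sum.cong refl) (simp add: qbinom_def mult_ac)
  thus ?thesis by (simp add: qvandermonde_limit[OF q])
qed

text \<open>Two steps of the Bailey chain relative to \<open>a = q\<close>, applied to a unit vector \<open>\<alpha>\<close>: with
  \<open>N = m + k - r\<close> and \<open>s = k - r\<close> the inner sum is a limiting \<open>q\<close>-Vandermonde sum, and what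
  remains is the Durfee rectangle expansion of \<open>1 / (q)\<^sub>\<infinity>\<close>.\<close>
lemma bailey_double_sum_nat:
  "((\<lambda>(m, k). bailey_weight q m k * qbinom_int q (2 * k + 1) (int k - int r))
      has_sum q ^ (2 * (r * (r + 1))) / qpoch_inf q q) UNIV"
proof -
  let ?F = "\<lambda>(m, k). bailey_weight q m k * qbinom_int q (2 * k + 1) (int k - int r)"
  let ?S = "{(m::nat, k). r \<le> k}"
  let ?D = "Sigma UNIV (\<lambda>N::nat. {..N})"
  let ?c = "2 * r + 1"
  let ?e = "q ^ (2 * (r * (r + 1)))"
  let ?G = "\<lambda>(N, s). ?e * q ^ (N * (N + ?c)) *
      (q ^ (s * (s + ?c)) / (qpoch q q (N - s) * qpoch q q s * qpoch q q (s + ?c)))"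
  obtain C where C: "\<And>n k. norm (qbinom_int q n k) \<le> C"
    using qbinom_int_bounded[OF q] by blast
  \<comment> \<open>A one-point third index specialises the general summability lemma to a double
    sum.\<close>
  have "(\<lambda>((m, k), j::unit). bailey_weight q m k * qbinom_int q (2 * k + 1) (int k - int r))
      summable_on UNIV"
    by (rule summable_bailey_weight_mult[where M = "\<lambda>_. C"]) (auto intro: C summable_on_finite)
  hence "?F summable_on UNIV"
    by (subst summable_on_reindex_bij_witness[where i = fst and j = "\<lambda>x. (x, ())" and T = UNIV])
       auto
  hence F: "?F summable_on ?S"
    by (rule summable_on_subset_banach) simp
  have eq: "?F (N - s, r + s) = ?G (N, s)" if "s \<le> N" for N s
  proof -
    \<comment> \<open>With k = r + s and m + k = N + r the exponent separates into parts in r, N and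
      s alone.\<close>
    have "(r + s) * (r + s + 1) + (N + r) * (N + r + 1)
        = 2 * (r * (r + 1)) + N * (N + ?c) + s * (s + ?c)"
      by (simp add: algebra_simps)
    hence "q ^ ((r + s) * (r + s + 1) + (N + r) * (N + r + 1))
        = ?e * q ^ (N * (N + ?c)) * q ^ (s * (s + ?c))"
      by (simp only: power_add)
    moreover have "N - s + (r + s) = N + r" using that by simp
    moreover have "qbinom_int q (2 * (r + s) + 1) (int (r + s) - int r)
        = qpoch q q (2 * (r + s) + 1) / (qpoch q q s * qpoch q q (s + ?c))"
    proof -
      have "int (r + s) - int r = int s" "2 * (r + s) + 1 - s = s + ?c" by simp_all
      thus ?thesis by (simp only: qbinom_int_of_nat) (simp add: qbinom_def)
    qed
    ultimately show ?thesis
      using qpoch_self_nonzero[OF q]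
      by (simp only: bailey_weight_def prod.case) (simp add: divide_simps)
  qed
  have transfer: "(?F has_sum L) ?S \<longleftrightarrow> (?G has_sum L) ?D" for L
  proof (rule has_sum_reindex_bij_witness[where i = "\<lambda>(N, s). (N - s, r + s)"
          and j = "\<lambda>(m, k). (m + k - r, k - r)"])
    fix a :: "nat \<times> nat" assume "a \<in> ?S"
    then obtain m k where a: "a = (m, k)" and "r \<le> k" by auto
    hence "k - r \<le> m + k - r" "m + k - r - (k - r) = m" "r + (k - r) = k" by auto
    with eq[of "k - r" "m + k - r"] show "?G (case a of (m, k) \<Rightarrow> (m + k - r, k - r)) = ?F a"
      unfolding a prod.case by simp
  qed auto
  have "(?G has_sum ?e * (1 / qpoch_inf q q)) ?D"
  proof (rule has_sum_SigmaI)
    show "((\<lambda>s. ?G (N, s)) has_sum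
        ?e * (q ^ (N * (N + ?c)) / (qpoch q q N * qpoch q q (N + ?c)))) {..N}" for N
      unfolding prod.case
      by (rule has_sum_finiteI)
         (simp_all only: finite_atMost sum_distrib_left[symmetric] qvandermonde_limit_symmetric, simp)
    show "((\<lambda>N. ?e * (q ^ (N * (N + ?c)) / (qpoch q q N * qpoch q q (N + ?c))))
        has_sum ?e * (1 / qpoch_inf q q)) UNIV"
      by (intro has_sum_cmult_right durfee_sum q)
    show "?G summable_on ?D"
      using F transfer by (auto simp: summable_on_def)
  qed
  hence "(?F has_sum ?e * (1 / qpoch_inf q q)) ?S"
    by (rule transfer[THEN iffD2])
  \<comment> \<open>Terms with k < r vanish, since their lower index is negative.\<close>
  also have "(?F has_sum ?e * (1 / qpoch_inf q q)) ?S \<longleftrightarrow> (?F has_sum ?e * (1 / qpoch_inf q q)) UNIV"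
    by (rule has_sum_cong_neutral) (auto simp: qbinom_int_eq_0)
  finally show ?thesis by simp
qed

text \<open>A negative r is replaced by -1-r: symmetry of the Gaussian coefficient sends k-r to
  k+1+r, and r(r+1) does not change.\<close>

lemma bailey_double_sum:
  "((\<lambda>(m, k). bailey_weight q m k * qbinom_int q (2 * k + 1) (int k - r))
      has_sum q ^ nat (2 * (r * (r + 1))) / qpoch_inf q q) UNIV"
proof (cases "r \<ge> 0")
  case True
  then obtain i where r: "r = int i" using nonneg_int_cases by blast
  have "nat (2 * (r * (r + 1))) = 2 * (i * (i + 1))"
    unfolding r by (metis nat_int of_nat_1 of_nat_add of_nat_mult of_nat_numeral)
  thus ?thesis using bailey_double_sum_nat[of i] by (simp only: r)
next
  case False
  define i where "i = nat (- 1 - r)"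
  have i: "- 1 - r = int i" using False by (simp add: i_def)
  have r: "r = - 1 - int i" using i by simp
  have "2 * (r * (r + 1)) = int (2 * (i * (i + 1)))"
    by (simp add: r algebra_simps)
  hence e: "nat (2 * (r * (r + 1))) = 2 * (i * (i + 1))" by (simp only: nat_int)
  have "qbinom_int q (2 * k + 1) (int k - r) = qbinom_int q (2 * k + 1) (int k - int i)" for k
    using qbinom_int_symmetric[of q "2 * k + 1" "int k - int i"] by (simp add: r algebra_simps)
  thus ?thesis using bailey_double_sum_nat[of i] by (simp only: e)
qed

section \<open>Summation over the bilateral index\<close>

lemma bressoud_a_theta:
  "bressoud_a q j * q ^ nat (2 * (2 * j * (2 * j + 1))) = theta_term (q ^ 15) (q ^ 6) j"
proof -
  let ?a = "j * (j + 1) div 2" and ?b = "j * (j - 1) div 2"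
  \<comment> \<open>The constants are forced: writing (21j^2 + 9j)/2 as u j(j+1)/2 + v j(j-1)/2
    requires u + v = 21 and u - v = 9.\<close>
  have "E + 2 * (2 * j * (2 * j + 1)) = 15 * A + 6 * B"
    if "2 * A = j * (j + 1)" "2 * B = j * (j - 1)" "2 * E = j * (5 * j + 1)" for A B E
    using that by (simp add: algebra_simps)
  from this[OF two_times_triangle two_times_triangle' two_times_half_5_1]
  have "j * (5 * j + 1) div 2 + 2 * (2 * j * (2 * j + 1)) = 15 * ?a + 6 * ?b" .
  moreover have "2 * (2 * j * (2 * j + 1)) \<ge> 0"
    using int_mult_linear_nonneg[of 1 2 j] by simp
  ultimately have "q ^ nat (j * (5 * j + 1) div 2) * q ^ nat (2 * (2 * j * (2 * j + 1)))
      = q ^ nat (15 * ?a) * q ^ nat (6 * ?b)"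
    using triangle_nonneg[of j] triangle_nonneg'[of j] half_5_1_nonneg[of j]
    by (simp only: nat_power_combine mult_nonneg_nonneg zero_le_numeral)
  thus ?thesis
    by (simp add: bressoud_a_def theta_term_def nat_mult_distrib power_mult)
qed

lemma summable_bressoud_a: "(\<lambda>j. norm (bressoud_a q j)) summable_on UNIV"
proof (rule Infinite_Sum.abs_summable_on_comparison_test'[OF summable_on_int_power[of "norm q"]])
  fix j :: int
  have "2 * \<bar>j\<bar> \<le> j * (5 * j + 1)"
    using abs_le_square_int[of j] unfolding ring_distribs by linarith
  hence "\<bar>j\<bar> \<le> j * (5 * j + 1) div 2" by linarith
  thus "norm (bressoud_a q j) \<le> norm q ^ nat \<bar>j\<bar>"
    using q by (auto simp: bressoud_a_def alt_def norm_mult norm_power intro!: power_decreasing)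
qed (use q in auto)

lemma has_sum_qbinom_series:
  "((\<lambda>j. c j * qbinom_int q n (m - 2 * j)) has_sum qbinom_series q c n m) UNIV"
  unfolding qbinom_series_def by (rule has_sum_infsum[OF summable_on_qbinom_int])

lemma bailey_weight_bressoud_sum:
  "((\<lambda>(m, k). bailey_weight q m k * (\<Sum>n\<le>k. q ^ n\<^sup>2 * qbinom q k n))
      has_sum qpoch_inf (q ^ 21) (q ^ 21) * qpoch_inf (q ^ 6) (q ^ 21) * qpoch_inf (q ^ 15) (q ^ 21)
        / qpoch_inf q q) UNIV"
  (is "(_ has_sum ?L) _")
proof -
  let ?h = "\<lambda>((m, k), j). bailey_weight q m k * (bressoud_a q j * qbinom_int q (2 * k + 1) (int k - 2 * j))"
  obtain C where C: "\<And>n k. norm (qbinom_int q n k) \<le> C" "C \<ge> 0"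
    using qbinom_int_bounded[OF q] by blast
  have summable: "?h summable_on (UNIV \<times> UNIV)"
  proof -
    have "?h summable_on UNIV"
    proof (rule summable_bailey_weight_mult)
      show "(\<lambda>j. norm (bressoud_a q j) * C) summable_on UNIV"
        by (intro summable_on_cmult_left summable_bressoud_a)
      show "norm (bressoud_a q j * qbinom_int q (2 * k + 1) (int k - 2 * j)) \<le> norm (bressoud_a q j) * C"
        for m k j
        unfolding norm_mult using C by (intro mult_mono) auto
    qed
    thus ?thesis by simp
  qed
  \<comment> \<open>With j outermost, the inner double sum is known for each j and the triple
    product evaluates what remains.\<close>
  have "((\<lambda>(j, mk). ?h (mk, j)) has_sum ?L) (UNIV \<times> UNIV)"
  proof (rule has_sum_SigmaI)
    show "((\<lambda>mk. case (j, mk) of (j, mk) \<Rightarrow> ?h (mk, j)) has_sum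
        theta_term (q ^ 15) (q ^ 6) j * (1 / qpoch_inf q q)) UNIV" for j
      using has_sum_cmult_right[OF bailey_double_sum[of "2 * j"], of "bressoud_a q j"]
        bressoud_a_theta[of j]
      by (simp add: case_prod_unfold mult_ac)
    have "norm (q ^ 15) < 1" "norm (q ^ 6) < 1"
      using q by (simp_all add: norm_power power_less_one_iff)
    moreover have "q ^ 21 = q ^ 15 * q ^ 6"
      by (simp flip: power_add)
    ultimately have "(theta_term (q ^ 15) (q ^ 6) has_sum
        qpoch_inf (q ^ 21) (q ^ 21) * qpoch_inf (q ^ 15) (q ^ 21) * qpoch_inf (q ^ 6) (q ^ 21)) UNIV"
      by (rule jacobi_triple_product)
    from has_sum_cmult_left[OF this, of "1 / qpoch_inf q q"]
    show "((\<lambda>j. theta_term (q ^ 15) (q ^ 6) j * (1 / qpoch_inf q q)) has_sum ?L) UNIV"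
      by (simp add: mult_ac)
    show "(\<lambda>(j, mk). ?h (mk, j)) summable_on (UNIV \<times> UNIV)"
      using summable by (rule summable_on_swap[THEN iffD1])
  qed
  hence "(?h has_sum ?L) (UNIV \<times> UNIV)"
    by (rule has_sum_swap[THEN iffD2])
  \<comment> \<open>In the opposite order the sum over j has finite support, and Bressoud's identity
    collapses it to the sum over n.\<close>
  thus ?thesis
  proof (rule has_sum_SigmaD)
    fix mk :: "nat \<times> nat"
    obtain m k where mk: "mk = (m, k)" by fastforce
    show "((\<lambda>j. ?h (mk, j)) has_sum
        (case mk of (m, k) \<Rightarrow> bailey_weight q m k * (\<Sum>n\<le>k. q ^ n\<^sup>2 * qbinom q k n))) UNIV"
      unfolding mk prod.case bressoud_identity[OF q]
      by (intro has_sum_cmult_right has_sum_qbinom_series)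
  qed
qed

text \<open>Passing from the iterated sum to the triple sum needs summability over all three indices
  at once; the bound |q|^(n^2) \<le> |q|^n provides it.\<close>

lemma bailey_weight_triple_sum:
  "((\<lambda>((m, k), n). bailey_weight q m k * (q ^ n\<^sup>2 * qbinom q k n))
      has_sum qpoch_inf (q ^ 21) (q ^ 21) * qpoch_inf (q ^ 6) (q ^ 21) * qpoch_inf (q ^ 15) (q ^ 21)
        / qpoch_inf q q) UNIV"
proof -
  let ?f = "\<lambda>((m, k), n). bailey_weight q m k * (q ^ n\<^sup>2 * qbinom q k n)"
  obtain C where C: "\<And>n k. norm (qbinom q n k) \<le> C" "C \<ge> 0"
    using qbinom_bounded[OF q] by blast
  have "?f summable_on UNIV"
  proof (rule summable_bailey_weight_mult)
    show "(\<lambda>n. norm q ^ n * C) summable_on UNIV"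
      by (intro summable_on_cmult_left summable_on_norm_power q)
    show "norm (q ^ n\<^sup>2 * qbinom q k n) \<le> norm q ^ n * C" for m k n
      unfolding norm_mult norm_power using C q
      by (intro mult_mono power_decreasing) (auto simp: power2_eq_square)
  qed
  moreover have "((\<lambda>n. ?f (mk, n)) has_sum
      (case mk of (m, k) \<Rightarrow> bailey_weight q m k * (\<Sum>n\<le>k. q ^ n\<^sup>2 * qbinom q k n))) UNIV" for mk
  proof -
    obtain m k where mk: "mk = (m, k)" by fastforce
    have "((\<lambda>n. q ^ n\<^sup>2 * qbinom q k n) has_sum (\<Sum>n\<le>k. q ^ n\<^sup>2 * qbinom q k n)) UNIV"
      by (rule has_sum_finite_neutralI[of "{..k}"]) (auto simp: qbinom_eq_0)
    thus ?thesis unfolding mk prod.case by (rule has_sum_cmult_right)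
  qed
  ultimately show ?thesis
    using has_sum_SigmaI[OF _ bailey_weight_bressoud_sum, of ?f "\<lambda>_. UNIV"] by simp
qed

end

lemma two_times_T: "2 * T k = k * (k + 1)"
  unfolding T_def by (rule dvd_mult_div_cancel) (auto simp: even_mult_iff)

theorem mainTheorem8:
  fixes q :: complex
  assumes "norm q < 1"
  shows "((\<lambda>(m, k, n).
            q ^ (2 * T k + 2 * T (m + k) + n ^ 2) / (qpoch q q m * qpoch q q (2 * k + 1))
              * qbinom q k n)
          has_sum
            (qpoch_inf (q ^ 21) (q ^ 21) * qpoch_inf (q ^ 6) (q ^ 21) * qpoch_inf (q ^ 15) (q ^ 21)
              / qpoch_inf q q))
         (UNIV :: (nat \<times> nat \<times> nat) set)"
  using bailey_weight_triple_sum[OF assms]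
  by (subst has_sum_reindex_bij_witness[where T = UNIV and i = "\<lambda>((m, k), n). (m, k, n)"
        and j = "\<lambda>(m, k, n). ((m, k), n)"])
     (auto simp: bailey_weight_def two_times_T power_add)

end
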